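(* Let $f(z)=z+\sum_{n\ge 2}a_nz^n\in\mathcal{BT}_{\mathfrak{B}}$ and let $\gamma_n=\gamma_n(f)$ be its logarithmic coefficients. Then $$|\gamma_n|\le \frac{1}{4(n+1)}\qquad\text{for } n=1,2,3,4,$$ that is, $|\gamma_1|\le 1/8$, $|\gamma_2|\le 1/12$, $|\gamma_3|\le 1/16$, $|\gamma_4|\le 1/20$. For each $n\in\{1,2,3,4\}$ the bound is attained by the function $f_n(z)=\int_0^z\sqrt{1+\tanh(t^n)}\,dt$.
   Context: $\mathbb{D}=\{z\in\mathbb{C}:|z|<1\}$. $\mathcal{S}$ is the class of univalent analytic functions $f$ on $\mathbb{D}$ normalized by $f(0)=0$, $f'(0)=1$, i.e. $f(z)=z+\sum_{n\ge2}a_nz^n$. For analytic $g,h$ on $\mathbb{D}$, $g\prec h$ (subordination) means there is an analytic $\omega:\mathbb{D}\to\mathbb{D}$ with $\omega(0)=0$ and $g=h\circ\omega$. Let $\mathfrak{B}(z)=\sqrt{1+\tanh z}$ (principal branch, $\mathfrak{B}(0)=1$). The class $\mathcal{BT}_{\mathfrak{B}}$ is $\{f\in\mathcal{S}: f'(z)\prec \mathfrak{B}(z)\}$. The logarithmic coefficients $\gamma_n(f)$ are defined by $\log\frac{f(z)}{z}=2\sum_{n\ge1}\gamma_n(f)z^n$ (with $\log 1=0$); explicitly $\gamma_1=\tfrac12 a_2$, $\gamma_2=\tfrac12(a_3-\tfrac12a_2^2)$, $\gamma_3=\tfrac12(a_4-a_2a_3+\tfrac13a_2^3)$, $\gamma_4=\tfrac12(a_5-a_2a_4+a_2^2a_3-\tfrac12a_3^2-\tfrac14a_2^4)$.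 *)

theory Defs
  imports "HOL-Complex_Analysis.Complex_Analysis"
begin

definition Bfun :: "complex \<Rightarrow> complex" where
  "Bfun z = csqrt (1 + tanh z)"

definition subordinate :: "(complex \<Rightarrow> complex) \<Rightarrow> (complex \<Rightarrow> complex) \<Rightarrow> bool" where
  "subordinate g h \<longleftrightarrow>
     (\<exists>\<omega>. \<omega> holomorphic_on ball 0 1 \<and> \<omega> ` ball 0 1 \<subseteq> ball 0 1 \<and> \<omega> 0 = 0 \<and>
          (\<forall>z\<in>ball 0 1. g z = h (\<omega> z)))"

definition classS :: "(complex \<Rightarrow> complex) set" where
  "classS = {f. f holomorphic_on ball 0 1 \<and> inj_on f (ball 0 1) \<and> f 0 = 0 \<and> deriv f 0 = 1}"

definition classBT :: "(complex \<Rightarrow> complex) set" where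
  "classBT = {f \<in> classS. subordinate (deriv f) Bfun}"

text \<open>Logarithmic coefficients: log(f(z)/z) = 2 \<Sum> gamma_n z^n, with the removable singularity
  of f(z)/z at 0 filled in by its value f'(0) = 1 and log the principal branch (log 1 = 0);
  gamma_n is half the n-th Taylor coefficient at 0.\<close>
definition logcoeff :: "(complex \<Rightarrow> complex) \<Rightarrow> nat \<Rightarrow> complex" where
  "logcoeff f n = (deriv ^^ n) (\<lambda>z. Ln (if z = 0 then 1 else f z / z)) 0 / (2 * fact n)"

definition fext :: "nat \<Rightarrow> complex \<Rightarrow> complex" where
  "fext n z = contour_integral (linepath 0 z) (\<lambda>t. Bfun (t ^ n))"

end

theory Submission
  imports Defs
begin

text \<open>If \<open>f' = B \<circ> w\<close>, the differential equation \<open>2 B' = B (2 - B\<^sup>2)\<close> expresses the logarithmic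
  coefficients of \<open>f\<close> as polynomials in the Taylor coefficients \<open>c\<^sub>k\<close> of the Schwarz function \<open>w\<close>,
  and \<open>4 (n + 1) \<gamma>\<^sub>n\<close> equals \<open>c\<^sub>n\<close> plus terms of higher degree. Multiplication by \<open>w\<close> is a contraction
  of \<open>H\<^sup>2\<close>; applying it to a polynomial \<open>p\<close> with \<open>p 0 = 1\<close> whose other coefficients are suitable
  polynomials in the \<open>c\<^sub>k\<close> makes \<open>4 (n + 1) \<gamma>\<^sub>n\<close> the \<open>n\<close>-th coefficient of \<open>w p\<close>, and the remaining
  coefficients of \<open>w p\<close> already dominate those of \<open>p - 1\<close>. Hence \<open>\<bar>4 (n + 1) \<gamma>\<^sub>n\<bar> \<le> 1\<close>. The choice
  \<open>w z = z ^ n\<close> gives equality.\<close>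

unbundle no vec_syntax

section \<open>The function \<open>Bfun\<close> on the unit disc, and a univalence criterion\<close>

text \<open>The argument \<open>-2 * Im z\<close> of \<open>exp (-2 * z)\<close> lies strictly
  between -pi and pi, so a real value of this exponential is positive. This keeps the square root in
  \<open>Bfun\<close> away from its branch cut.\<close>

lemma one_plus_exp_notin_nonpos_Reals:
  fixes z :: complex
  assumes "cmod z < 1"
  shows "1 + exp (-2 * z) \<notin> \<real>\<^sub>\<le>\<^sub>0"
proof
  assume *: "1 + exp (-2 * z) \<in> \<real>\<^sub>\<le>\<^sub>0"
  define y where "y = -2 * Im z"
  have "\<bar>y\<bar> < 2"
    using abs_Im_le_cmod[of z] assms by (simp add: y_def)
  hence y: "\<bar>y\<bar> < pi"
    using pi_gt3 by linarith
  have "sin y = 0" and re: "1 + exp (-2 * Re z) * cos y \<le> 0"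
    using * by (auto simp: complex_nonpos_Reals_iff Re_exp Im_exp y_def)
  hence "y = 0"
    using sin_eq_0_pi y by force
  thus False
    using re exp_gt_zero[of "-2 * Re z"] by (simp add: y_def del: exp_gt_zero)
qed

lemma one_plus_tanh:
  fixes z :: complex
  assumes "cmod z < 1"
  shows "cosh z \<noteq> 0" and "1 + tanh z = 2 / (1 + exp (-2 * z))"
proof -
  have nz: "1 + exp (-2 * z) \<noteq> 0"
    using one_plus_exp_notin_nonpos_Reals[OF assms] by force
  have 1: "exp z + exp (-z) = exp z * (1 + exp (-2 * z))"
    by (simp add: distrib_left flip: exp_add)
  hence nz': "exp z + exp (-z) \<noteq> 0"
    using nz by simp
  thus "cosh z \<noteq> 0"
    by (simp add: cosh_def)
  have "1 + tanh z = 2 * exp z / (exp z + exp (-z))"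
    using nz' by (simp add: tanh_altdef field_simps)
  thus "1 + tanh z = 2 / (1 + exp (-2 * z))"
    unfolding 1 by simp
qed

text \<open>With \<open>1 + tanh z = 2 / w\<close>, a value on the cut would put
  \<open>w = 1 + exp (-2 * z)\<close> on the cut as well.\<close>

lemma one_plus_tanh_notin_nonpos_Reals:
  fixes z :: complex
  assumes "cmod z < 1"
  shows "1 + tanh z \<notin> \<real>\<^sub>\<le>\<^sub>0"
proof
  define w where "w = 1 + exp (-2 * z)"
  assume "1 + tanh z \<in> \<real>\<^sub>\<le>\<^sub>0"
  then obtain x where x: "2 / w = complex_of_real x" "x \<le> 0"
    unfolding one_plus_tanh(2)[OF assms] w_def by (elim nonpos_Reals_cases) auto
  have "w \<noteq> 0"
    using one_plus_exp_notin_nonpos_Reals[OF assms] by (force simp: w_def)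
  hence "w = complex_of_real (2 / x)"
    using x(1) by (cases "x = 0") (auto simp: field_simps)
  hence "w \<in> \<real>\<^sub>\<le>\<^sub>0"
    using x(2) by (simp only: nonpos_Reals_of_real_iff) (simp add: divide_le_0_iff)
  thus False
    using one_plus_exp_notin_nonpos_Reals[OF assms] by (simp add: w_def)
qed

lemma Bfun_0 [simp]: "Bfun 0 = 1"
  by (simp add: Bfun_def)

text \<open>A principal square root has nonnegative real part; real part 0 would make its square a
  nonpositive real.\<close>

lemma Re_Bfun_pos:
  assumes "cmod z < 1"
  shows "Re (Bfun z) > 0"
  using csqrt_principal[of "1 + tanh z"] one_plus_tanh_notin_nonpos_Reals[OF assms]
  unfolding Bfun_def
  by (smt (verit) Re_csqrt csqrt_eq_0 complex_nonpos_Reals_iff nonpos_Reals_zero_I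
        Im_power2 Re_power2 power2_csqrt power2_eq_square mult_eq_0_iff mult_nonneg_nonneg)

text \<open>Since \<open>Bfun z ^ 2 = 1 + tanh z\<close>, also \<open>1 - tanh z ^ 2\<close> is a
  polynomial in \<open>Bfun z\<close>. The resulting differential equation is autonomous, which
  makes the later coefficient recursion polynomial.\<close>

lemma has_field_derivative_Bfun:
  assumes "cmod z < 1"
  shows "(Bfun has_field_derivative Bfun z * (2 - Bfun z ^ 2) / 2) (at z)"
proof -
  have nz: "Bfun z \<noteq> 0"
    using Re_Bfun_pos[OF assms] by auto
  have sq: "Bfun z ^ 2 = 1 + tanh z"
    by (simp add: Bfun_def)
  have "(Bfun has_field_derivative ((1 - tanh z ^ 2) / (2 * Bfun z))) (at z)"
    unfolding Bfun_def
    by (rule derivative_eq_intros refl one_plus_tanh one_plus_tanh_notin_nonpos_Reals assms | simp)+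
  also have "1 - tanh z ^ 2 = Bfun z ^ 2 * (2 - Bfun z ^ 2)"
    unfolding sq by (simp add: power2_eq_square algebra_simps)
  finally show ?thesis
    using nz by (simp add: power2_eq_square)
qed

lemma Noshiro_Warschawski:
  assumes "convex S" and "\<And>z. z \<in> S \<Longrightarrow> (f has_field_derivative f' z) (at z)"
    and "\<And>z. z \<in> S \<Longrightarrow> Re (f' z) > 0"
  shows "inj_on f S"
proof (rule inj_onI, rule ccontr)
  fix a b assume ab: "a \<in> S" "b \<in> S" "f a = f b" "a \<noteq> b"
  have seg: "closed_segment a b \<subseteq> S"
    using ab assms(1) closed_segment_subset by blast
  \<comment> \<open>The mean value theorem controls real parts only. The factor
    \<open>cnj (b - a)\<close> turns the increment into \<open>f' u\<close> times the positive real
    \<open>(cmod (b - a))\<^sup>2\<close>.\<close>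
  have "\<exists>u. u \<in> closed_segment a b \<and>
          Re (cnj (b - a) * f b) - Re (cnj (b - a) * f a) = Re (cnj (b - a) * f' u * (b - a))"
    using seg assms(2) by (intro complex_mvt_line DERIV_cmult) auto
  then obtain u where u: "u \<in> S" "Re (cnj (b - a) * f' u * (b - a)) = 0"
    using seg ab(3) by auto
  have "cnj (b - a) * f' u * (b - a) = f' u * of_real ((cmod (b - a))\<^sup>2)"
    by (simp only: complex_norm_square) (simp add: algebra_simps)
  hence "Re (f' u) * (cmod (b - a))\<^sup>2 = 0"
    using u(2) by (metis Re_complex_of_real Im_complex_of_real times_complex.sel(1) mult_zero_right diff_zero)
  thus False
    using assms(3)[OF u(1)] ab(4) by simp
qed

section \<open>Logarithmic coefficients as polynomials in the Schwarz coefficients\<close>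

text \<open>Here \<open>W\<close>, \<open>F\<close>, \<open>H\<close>, \<open>L\<close> stand for
  the series of the Schwarz function, of f, of f' and of log (f z / z). Comparing coefficients in
  the three differential equations determines \<open>H\<close>, then \<open>fps_shift 1 F\<close>,
  then \<open>L\<close>, so that \<open>L $ n\<close> is twice the n-th logarithmic
  coefficient.\<close>

lemma fps_log_coeffs_of_ODE:
  fixes W H F L :: "complex fps"
  assumes W0: "W $ 0 = 0" and H0: "H $ 0 = 1" and F0: "F $ 0 = 0" and L0: "L $ 0 = 0"
    and H: "2 * fps_deriv H = H * (2 - H\<^sup>2) * fps_deriv W"
    and F: "fps_deriv F = H"
    and L: "fps_deriv L * fps_shift 1 F = fps_deriv (fps_shift 1 F)"
  shows "L $ 1 = W $ 1 / 4"
    and "L $ 2 = (W $ 2 - 7/16 * (W $ 1)\<^sup>2) / 6"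
    and "L $ 3 = (W $ 3 - 5/6 * W $ 1 * W $ 2 - 1/12 * (W $ 1) ^ 3) / 8"
    and "L $ 4 = (W $ 4 - 13/16 * W $ 1 * W $ 3 - 7/18 * (W $ 2)\<^sup>2
            - 85/288 * (W $ 1)\<^sup>2 * W $ 2 + 503/4608 * (W $ 1) ^ 4) / 10"
proof -
  define G where "G = fps_shift 1 F"
  define T where "T = H * H"
  define M where "M = H * (2 - T)"
  have G: "of_nat (Suc n) * G $ n = H $ n" for n
    using arg_cong[OF F, of "\<lambda>X. X $ n"] by (simp add: G_def)
  have H': "2 * of_nat (Suc n) * H $ Suc n = (M * fps_deriv W) $ n" for n
    using arg_cong[OF H, of "\<lambda>X. X $ n"]
    by (simp add: T_def M_def power2_eq_square algebra_simps numeral_fps_const)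
  have L': "of_nat (Suc n) * G $ Suc n = (fps_deriv L * G) $ n" for n
    using arg_cong[OF L, of "\<lambda>X. X $ n"] by (simp add: G_def)
  note nth = fps_mult_nth numeral_eq_Suc atLeast0AtMost atMost_Suc fps_numeral_nth
  have t: "T $ 1 = 2 * H $ 1" "T $ 2 = 2 * H $ 2 + (H $ 1)\<^sup>2"
    "T $ 3 = 2 * H $ 3 + 2 * H $ 1 * H $ 2"
    by (simp_all add: T_def nth H0)
  have T0: "T $ 0 = 1"
    by (simp add: T_def H0)
  \<comment> \<open>This constant term makes \<open>W $ n\<close> enter \<open>H $ n\<close>
    linearly with factor 1/2; all other terms involve lower indices only.\<close>
  have M0: "M $ 0 = 1"
    by (simp add: M_def H0 T0)
  have m: "M $ 1 = H $ 1 - T $ 1" "M $ 2 = H $ 2 - H $ 1 * T $ 1 - T $ 2"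
    "M $ 3 = H $ 3 - H $ 2 * T $ 1 - H $ 1 * T $ 2 - T $ 3"
    using T0 by (simp_all add: M_def nth H0 algebra_simps)
  have h1: "H $ 1 = W $ 1 / 2"
    using H'[of 0] M0 by (simp add: nth field_simps)
  have "H $ 2 = (2 * W $ 2 + M $ 1 * W $ 1) / 4"
    using H'[of 1] M0 by (simp add: nth field_simps)
  also have "\<dots> = W $ 2 / 2 - (W $ 1)\<^sup>2 / 8"
    unfolding m t h1 by (simp add: field_simps power2_eq_square)
  finally have h2: "H $ 2 = W $ 2 / 2 - (W $ 1)\<^sup>2 / 8" .
  have "H $ 3 = (3 * W $ 3 + 2 * M $ 1 * W $ 2 + M $ 2 * W $ 1) / 6"
    using H'[of 2] M0 by (simp add: nth field_simps)
  also have "\<dots> = W $ 3 / 2 - W $ 1 * W $ 2 / 4 - 5 / 48 * (W $ 1) ^ 3"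
    unfolding m t h1 h2 by (simp add: field_simps power2_eq_square power3_eq_cube)
  finally have h3: "H $ 3 = W $ 3 / 2 - W $ 1 * W $ 2 / 4 - 5 / 48 * (W $ 1) ^ 3" .
  have "H $ 4 = (4 * W $ 4 + 3 * M $ 1 * W $ 3 + 2 * M $ 2 * W $ 2 + M $ 3 * W $ 1) / 8"
    using H'[of 3] M0 by (simp add: nth field_simps)
  also have "\<dots> = W $ 4 / 2 - W $ 1 * W $ 3 / 4 - (W $ 2)\<^sup>2 / 8
      - 5 / 16 * (W $ 1)\<^sup>2 * W $ 2 + 17 / 384 * (W $ 1) ^ 4"
    unfolding m t h1 h2 h3 by (simp add: field_simps power2_eq_square power3_eq_cube power4_eq_xxxx)
  finally have h4: "H $ 4 = W $ 4 / 2 - W $ 1 * W $ 3 / 4 - (W $ 2)\<^sup>2 / 8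
      - 5 / 16 * (W $ 1)\<^sup>2 * W $ 2 + 17 / 384 * (W $ 1) ^ 4" .
  have G0: "G $ 0 = 1"
    using G[of 0] H0 by simp
  have g: "G $ 1 = H $ 1 / 2" "G $ 2 = H $ 2 / 3" "G $ 3 = H $ 3 / 4" "G $ 4 = H $ 4 / 5"
    using G[of 1] G[of 2] G[of 3] G[of 4] by (simp_all add: field_simps numeral_eq_Suc)
  have "L $ 1 = G $ 1"
    using L'[of 0] G0 by (simp add: nth)
  thus l1: "L $ 1 = W $ 1 / 4"
    unfolding g h1 by simp
  have "L $ 2 = (2 * G $ 2 - L $ 1 * G $ 1) / 2"
    using L'[of 1] G0 by (simp add: nth field_simps)
  also have "\<dots> = (W $ 2 - 7/16 * (W $ 1)\<^sup>2) / 6"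
    unfolding g h1 h2 l1 by (simp add: field_simps power2_eq_square)
  finally show l2: "L $ 2 = (W $ 2 - 7/16 * (W $ 1)\<^sup>2) / 6" .
  have "L $ 3 = (3 * G $ 3 - L $ 1 * G $ 2 - 2 * L $ 2 * G $ 1) / 3"
    using L'[of 2] G0 by (simp add: nth field_simps)
  also have "\<dots> = (W $ 3 - 5/6 * W $ 1 * W $ 2 - 1/12 * (W $ 1) ^ 3) / 8"
    unfolding g h1 h2 h3 l1 l2 by (simp add: field_simps power2_eq_square power3_eq_cube)
  finally show l3: "L $ 3 = (W $ 3 - 5/6 * W $ 1 * W $ 2 - 1/12 * (W $ 1) ^ 3) / 8" .
  have "L $ 4 = (4 * G $ 4 - L $ 1 * G $ 3 - 2 * L $ 2 * G $ 2 - 3 * L $ 3 * G $ 1) / 4"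
    using L'[of 3] G0 by (simp add: nth field_simps)
  also have "\<dots> = (W $ 4 - 13/16 * W $ 1 * W $ 3 - 7/18 * (W $ 2)\<^sup>2
            - 85/288 * (W $ 1)\<^sup>2 * W $ 2 + 503/4608 * (W $ 1) ^ 4) / 10"
    unfolding g h1 h2 h3 h4 l1 l2 l3
    by (simp add: field_simps power2_eq_square power3_eq_cube power4_eq_xxxx)
  finally show "L $ 4 = (W $ 4 - 13/16 * W $ 1 * W $ 3 - 7/18 * (W $ 2)\<^sup>2
            - 85/288 * (W $ 1)\<^sup>2 * W $ 2 + 503/4608 * (W $ 1) ^ 4) / 10" .
qed

section \<open>Coefficient inequality for bounded multipliers\<close>

text \<open>Cauchy's formula for the k-th derivative: on the circle of radius r the conjugate of z
  is r^2 / z, and dz = 2 pi i z dt, so the Cauchy kernel becomes a power of the conjugate.\<close>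

lemma has_integral_circle_coeff:
  fixes f :: "complex \<Rightarrow> complex"
  assumes f: "f holomorphic_on ball 0 1" and r: "0 < r" "r < 1"
  shows "((\<lambda>t. f (circlepath 0 r t) * cnj (circlepath 0 r t) ^ k)
           has_integral fps_expansion f 0 $ k * of_real r ^ (2 * k)) {0..1}"
proof -
  have "continuous_on (cball 0 r) f" "f holomorphic_on ball 0 r"
    using f r by (auto intro!: holomorphic_on_imp_continuous_on elim!: holomorphic_on_subset)
  hence "((\<lambda>u. f u / (u - 0) ^ Suc k) has_contour_integral
           2 * pi * \<i> / fact k * (deriv ^^ k) f 0) (circlepath 0 r)"
    by (rule Cauchy_has_contour_integral_higher_derivative_circlepath) (use r in auto)
  hence "((\<lambda>t. f (circlepath 0 r t) / circlepath 0 r t ^ Suc k * (2 * pi * \<i> * circlepath 0 r t))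
           has_integral 2 * pi * \<i> * fps_expansion f 0 $ k) {0..1}"
    unfolding has_contour_integral vector_derivative_circlepath
    by (simp add: fps_expansion_def circlepath mult_ac)
  from has_integral_mult_right[OF this, of "of_real r ^ (2 * k) / (2 * pi * \<i>)"]
  have "((\<lambda>t. of_real r ^ (2 * k) / (2 * pi * \<i>) *
             (f (circlepath 0 r t) / circlepath 0 r t ^ Suc k * (2 * pi * \<i> * circlepath 0 r t)))
           has_integral fps_expansion f 0 $ k * of_real r ^ (2 * k)) {0..1}"
    by (rule back_subst[where P = "\<lambda>i. (_ has_integral i) _"]) (simp add: field_simps)
  moreover have "of_real r ^ (2 * k) / (2 * pi * \<i>) *
        (f (circlepath 0 r t) / circlepath 0 r t ^ Suc k * (2 * pi * \<i> * circlepath 0 r t))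
      = f (circlepath 0 r t) * cnj (circlepath 0 r t) ^ k" for t
  proof -
    have nz: "circlepath 0 r t \<noteq> 0"
      using r by (simp add: circlepath)
    have "cmod (circlepath 0 r t) = r"
      using r by (simp add: circlepath norm_mult)
    hence "circlepath 0 r t * cnj (circlepath 0 r t) = of_real r ^ 2"
      by (simp flip: complex_norm_square)
    hence "of_real r ^ (2 * k) = (circlepath 0 r t * cnj (circlepath 0 r t)) ^ k"
      by (simp add: power_mult)
    moreover have "a / d * (x / c ^ Suc k * (d * c)) = a * x / c ^ k" if "c \<noteq> 0" "d \<noteq> 0" for a c d x :: complex
      using that by (simp add: field_simps)
    from this[OF nz, of "2 * pi * \<i>"]
    have "of_real r ^ (2 * k) / (2 * pi * \<i>) *
        (f (circlepath 0 r t) / circlepath 0 r t ^ Suc k * (2 * pi * \<i> * circlepath 0 r t))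
      = of_real r ^ (2 * k) * f (circlepath 0 r t) / circlepath 0 r t ^ k"
      by simp
    ultimately show ?thesis
      using nz by (simp only: power_mult_distrib) simp
  qed
  ultimately show ?thesis
    by simp
qed

lemma has_integral_circle_inner_poly:
  fixes f :: "complex \<Rightarrow> complex"
  assumes f: "f holomorphic_on ball 0 1" and r: "0 < r" "r < 1"
  shows "((\<lambda>t. f (circlepath 0 r t) * cnj (\<Sum>k\<le>n. c k * circlepath 0 r t ^ k))
           has_integral (\<Sum>k\<le>n. fps_expansion f 0 $ k * cnj (c k) * of_real r ^ (2 * k))) {0..1}"
proof -
  have "((\<lambda>t. \<Sum>k\<le>n. cnj (c k) * (f (circlepath 0 r t) * cnj (circlepath 0 r t) ^ k))
          has_integral (\<Sum>k\<le>n. cnj (c k) * (fps_expansion f 0 $ k * of_real r ^ (2 * k)))) {0..1}"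
    by (intro has_integral_sum has_integral_mult_right has_integral_circle_coeff assms) auto
  thus ?thesis
    by (simp add: sum_distrib_left mult_ac)
qed

lemma has_fps_expansion_truncated:
  fixes P :: "complex fps"
  shows "(\<lambda>z. \<Sum>k\<le>n. P $ k * z ^ k) has_fps_expansion fps_cutoff (Suc n) P"
proof -
  have "(\<lambda>z. \<Sum>k\<le>n. P $ k * z ^ k) has_fps_expansion (\<Sum>k\<le>n. fps_const (P $ k) * fps_X ^ k)"
    by (intro fps_expansion_intros)
  also have "(\<Sum>k\<le>n. fps_const (P $ k) * fps_X ^ k) = fps_cutoff (Suc n) P"
    by (rule fps_ext) (simp add: fps_sum_rep_nth less_Suc_eq_le flip: atLeast0AtMost)
  finally show ?thesis .
qed

text \<open>Expanding \<open>0 \<le> \<bar>p\<bar>\<^sup>2 - \<bar>g\<bar>\<^sup>2 + \<bar>g - s\<bar>\<^sup>2\<close> with \<open>s\<close> the truncated series of \<open>g\<close>,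
  the term \<open>\<bar>g\<bar>\<^sup>2\<close> cancels, so only inner products with polynomials have to be integrated.\<close>

lemma dominated_by_poly_coeffs_le:
  fixes g :: "complex \<Rightarrow> complex" and P :: "complex fps"
  assumes g: "g holomorphic_on ball 0 1"
    and le: "\<And>z. z \<in> ball 0 1 \<Longrightarrow> cmod (g z) \<le> cmod (\<Sum>k\<le>n. P $ k * z ^ k)"
  shows "(\<Sum>k\<le>n. (cmod (fps_expansion g 0 $ k))\<^sup>2) \<le> (\<Sum>k\<le>n. (cmod (P $ k))\<^sup>2)"
proof -
  define G where "G = fps_expansion g 0"
  define p where "p = (\<lambda>z. \<Sum>k\<le>n. P $ k * z ^ k)"
  define s where "s = (\<lambda>z. \<Sum>k\<le>n. G $ k * z ^ k)"
  have exp_trunc: "fps_expansion (\<lambda>z. \<Sum>k\<le>n. Q $ k * z ^ k) 0 = fps_cutoff (Suc n) Q" for Q :: "complex fps"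
    by (rule fps_ext)
       (simp only: fps_expansion_def fps_nth_Abs_fps fps_nth_fps_expansion[OF has_fps_expansion_truncated])
  have bound: "(\<Sum>k\<le>n. (cmod (G $ k))\<^sup>2 * r ^ (2 * k)) \<le> (\<Sum>k\<le>n. (cmod (P $ k))\<^sup>2 * r ^ (2 * k))"
    if r: "0 < r" "r < 1" for r :: real
  proof -
    define u where "u = circlepath 0 r"
    have u: "u t \<in> ball 0 1" for t
      using r by (simp add: u_def circlepath norm_mult)
    \<comment> \<open>Parseval's identity for a polynomial, as the inner product of the polynomial
      with itself.\<close>
    have self: "((\<lambda>t. (\<Sum>k\<le>n. Q $ k * u t ^ k) * cnj (\<Sum>k\<le>n. Q $ k * u t ^ k))
        has_integral (\<Sum>k\<le>n. Q $ k * cnj (Q $ k) * of_real r ^ (2 * k))) {0..1}" for Q :: "complex fps"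
    proof -
      have "(\<lambda>z. \<Sum>k\<le>n. Q $ k * z ^ k) holomorphic_on ball 0 1"
        by (intro holomorphic_intros)
      from has_integral_circle_inner_poly[OF this r, of "\<lambda>k. Q $ k" n]
      show ?thesis
        unfolding u_def exp_trunc by (simp cong: sum.cong_simp)
    qed
    have re: "Re (\<Sum>k\<le>n. Q $ k * cnj (Q $ k) * of_real r ^ (2 * k)) = (\<Sum>k\<le>n. (cmod (Q $ k))\<^sup>2 * r ^ (2 * k))"
      for Q :: "complex fps"
      by (simp add: Re_sum flip: complex_norm_square of_real_power of_real_mult)
    define S where "S = (\<Sum>k\<le>n. (cmod (G $ k))\<^sup>2 * r ^ (2 * k))"
    define T where "T = (\<Sum>k\<le>n. (cmod (P $ k))\<^sup>2 * r ^ (2 * k))"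
    have pp: "((\<lambda>t. Re (p (u t) * cnj (p (u t)))) has_integral T) {0..1}"
      using has_integral_Re[OF self[of P]] unfolding re T_def p_def .
    have ss: "((\<lambda>t. Re (s (u t) * cnj (s (u t)))) has_integral S) {0..1}"
      using has_integral_Re[OF self[of G]] unfolding re S_def s_def .
    have gs: "((\<lambda>t. Re (g (u t) * cnj (s (u t)))) has_integral S) {0..1}"
      using has_integral_Re[OF has_integral_circle_inner_poly[OF g r, of "\<lambda>k. G $ k" n]]
      unfolding G_def[symmetric] u_def[symmetric] re S_def s_def .
    have "0 \<le> T - 2 * S + S"
    proof (rule has_integral_nonneg)
      show "((\<lambda>t. Re (p (u t) * cnj (p (u t))) - 2 * Re (g (u t) * cnj (s (u t)))
              + Re (s (u t) * cnj (s (u t)))) has_integral T - 2 * S + S) {0..1}"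
        by (intro has_integral_add has_integral_diff has_integral_mult_right pp gs ss)
      fix t :: real
      have "(cmod (g (u t)))\<^sup>2 \<le> (cmod (p (u t)))\<^sup>2"
        using le[OF u] by (intro power_mono) (auto simp: p_def)
      moreover have "0 \<le> (cmod (g (u t) - s (u t)))\<^sup>2"
        by simp
      ultimately show "0 \<le> Re (p (u t) * cnj (p (u t))) - 2 * Re (g (u t) * cnj (s (u t)))
              + Re (s (u t) * cnj (s (u t)))"
        unfolding cmod_power2 by (simp add: power2_eq_square algebra_simps)
    qed
    thus ?thesis
      by (simp add: S_def T_def)
  qed
  \<comment> \<open>\<open>g\<close> is controlled inside the open disc only, so the circles have
    radius r < 1. Both sides of \<open>bound\<close> are polynomials in r, and r tends to 1.\<close>
  have lim: "((\<lambda>r. \<Sum>k\<le>n. (cmod (Q $ k))\<^sup>2 * r ^ (2 * k)) \<longlongrightarrow> (\<Sum>k\<le>n. (cmod (Q $ k))\<^sup>2 * 1 ^ (2 * k)))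
      (at_left (1::real))" for Q :: "complex fps"
    by (intro tendsto_intros)
  have "eventually (\<lambda>r::real. 0 < r \<and> r < 1) (at_left 1)"
    by (auto simp: eventually_at_left[of 0] intro: exI[of _ 0])
  hence "eventually (\<lambda>r. (\<Sum>k\<le>n. (cmod (G $ k))\<^sup>2 * r ^ (2 * k)) \<le> (\<Sum>k\<le>n. (cmod (P $ k))\<^sup>2 * r ^ (2 * k))) (at_left 1)"
    by eventually_elim (use bound in auto)
  from tendsto_le[OF _ lim lim this] show ?thesis
    by (simp add: G_def)
qed

text \<open>The product of \<open>w\<close> with the truncation of \<open>P\<close> is dominated by
  that truncation, and truncating \<open>P\<close> after index n leaves the coefficients of the
  product up to n unchanged.\<close>

lemma bounded_multiplier_coeffs_le:
  fixes w :: "complex \<Rightarrow> complex" and P :: "complex fps"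
  assumes w: "w holomorphic_on ball 0 1" and le: "\<And>z. z \<in> ball 0 1 \<Longrightarrow> cmod (w z) \<le> 1"
  shows "(\<Sum>k\<le>n. (cmod ((fps_expansion w 0 * P) $ k))\<^sup>2) \<le> (\<Sum>k\<le>n. (cmod (P $ k))\<^sup>2)"
proof -
  define g where "g = (\<lambda>z. w z * (\<Sum>k\<le>n. P $ k * z ^ k))"
  have "g has_fps_expansion fps_expansion w 0 * fps_cutoff (Suc n) P"
    unfolding g_def by (intro has_fps_expansion_mult has_fps_expansion_truncated has_fps_expansion_fps_expansion[OF _ _ w]) auto
  hence "fps_expansion g 0 = fps_expansion w 0 * fps_cutoff (Suc n) P"
    by (simp add: fps_eq_iff fps_expansion_def fps_nth_fps_expansion)
  hence "fps_expansion g 0 $ k = (fps_expansion w 0 * P) $ k" if "k \<le> n" for k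
    using that by (auto simp: fps_mult_nth intro!: sum.cong)
  moreover have "(\<Sum>k\<le>n. (cmod (fps_expansion g 0 $ k))\<^sup>2) \<le> (\<Sum>k\<le>n. (cmod (P $ k))\<^sup>2)"
  proof (rule dominated_by_poly_coeffs_le)
    show "g holomorphic_on ball 0 1"
      unfolding g_def by (intro holomorphic_intros w)
    show "cmod (g z) \<le> cmod (\<Sum>k\<le>n. P $ k * z ^ k)" if "z \<in> ball 0 1" for z
      using le[OF that] by (simp add: g_def norm_mult mult_left_le_one_le)
  qed
  ultimately show ?thesis
    by simp
qed

section \<open>Sharp estimates for the Schwarz functionals\<close>

text \<open>The two sides differ by a square. The coefficient of \<open>(cmod y)\<^sup>2\<close>
  must be 1 to cancel against the contraction inequality below, and 4/3 is then the least possible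
  factor for \<open>m\<close>.\<close>

lemma cmod_diff_half_sq_le:
  "(cmod (m - y / 2))\<^sup>2 \<le> (cmod y)\<^sup>2 + 4 / 3 * (cmod m)\<^sup>2"
proof -
  have "0 \<le> 4 / 3 * (cmod (m / 2 + 3 / 4 * y))\<^sup>2"
    by simp
  also have "\<dots> = (cmod y)\<^sup>2 + 4 / 3 * (cmod m)\<^sup>2 - (cmod (m - y / 2))\<^sup>2"
    unfolding cmod_power2 by (simp add: power2_eq_square algebra_simps)
  finally show ?thesis
    by simp
qed

text \<open>The hypothesis is applied to \<open>x1 = l1 c1\<close>, \<open>x2 = l2 c2 + l3 c1\<^sup>2\<close> and, in the next lemma,
  \<open>x3 = l4 c3 + l5 c1 c2 + l6 c1\<^sup>3\<close>. The functional fixes \<open>l1 + l2\<close>, \<open>l3\<close> here, and \<open>l2\<close>, \<open>l6\<close>, \<open>l1 + l4\<close>,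
  \<open>l3 + l5\<close> there. The remaining freedom serves to make the quadratic form in \<open>quad\<close>
  positive semidefinite.\<close>

lemma Schwarz_functional_3:
  fixes c1 c2 c3 :: complex
  assumes c1: "cmod c1 \<le> 1"
    and contr: "\<And>x1 x2. (cmod c1)\<^sup>2 + (cmod (c2 + x1 * c1))\<^sup>2 + (cmod (c3 + x1 * c2 + x2 * c1))\<^sup>2
              \<le> 1 + (cmod x1)\<^sup>2 + (cmod x2)\<^sup>2"
  shows "cmod (c3 - 5/6 * c1 * c2 - 1/12 * c1 ^ 3) \<le> 1"
proof -
  define u where "u = c1\<^sup>2"
  \<comment> \<open>The coefficient -5/6 of \<open>c1 * c2\<close> is split evenly between
    \<open>x1 * c2\<close> and \<open>x2 * c1\<close>; the latter also carries the cubic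
    term.\<close>
  define x1 where "x1 = - 5/12 * c1"
  define x2 where "x2 = - 5/12 * c2 - 1/12 * u"
  define T where "T = c3 - 5/6 * c1 * c2 - 1/12 * c1 ^ 3"
  have e2: "c2 + x1 * c1 = c2 - 5/12 * u"
    by (simp add: x1_def u_def power2_eq_square)
  have e3: "c3 + x1 * c2 + x2 * c1 = T"
    by (simp add: T_def x1_def x2_def u_def power2_eq_square power3_eq_cube algebra_simps)
  \<comment> \<open>Replacing \<open>c1\<close> by its square in the norm leaves a quadratic form in
    \<open>u\<close> and \<open>c2\<close>. Its coefficients are real, so real and imaginary parts
    can be treated separately.\<close>
  have u: "(cmod u)\<^sup>2 \<le> (cmod c1)\<^sup>2"
    using c1 by (intro power_mono) (auto simp: u_def norm_mult power2_eq_square mult_left_le)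
  have quad: "25/144 * s\<^sup>2 + (5/12 * p + 1/12 * s)\<^sup>2 \<le> s\<^sup>2 + (p - 5/12 * s)\<^sup>2" for p s :: real
  proof -
    \<comment> \<open>The weight of \<open>(p - s)\<^sup>2\<close> is fixed by the mixed term; the
      diagonal terms left over have positive coefficients.\<close>
    have "0 \<le> 65/144 * (p - s)\<^sup>2 + 3/8 * p\<^sup>2 + 13/24 * s\<^sup>2"
      by simp
    also have "\<dots> = s\<^sup>2 + (p - 5/12 * s)\<^sup>2 - (25/144 * s\<^sup>2 + (5/12 * p + 1/12 * s)\<^sup>2)"
      by (simp add: power2_eq_square field_simps)
    finally show ?thesis
      by simp
  qed
  have "25/144 * (cmod u)\<^sup>2 + (cmod x2)\<^sup>2 \<le> (cmod u)\<^sup>2 + (cmod (c2 - 5/12 * u))\<^sup>2"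
    using quad[of "Re u" "Re c2"] quad[of "Im u" "Im c2"]
    unfolding cmod_power2 x2_def by (simp add: power2_eq_square algebra_simps add_divide_distrib)
  moreover have "(cmod x1)\<^sup>2 = 25/144 * (cmod c1)\<^sup>2"
    by (simp add: x1_def norm_mult power_mult_distrib power2_eq_square)
  ultimately have "(cmod T)\<^sup>2 \<le> 1"
    using contr[of x1 x2, unfolded e2 e3] u by linarith
  hence "cmod T \<le> 1"
    by (simp add: abs_square_le_1)
  thus ?thesis
    unfolding T_def .
qed

lemma Schwarz_functional_4:
  fixes c1 c2 c3 c4 :: complex
  assumes c1: "cmod c1 \<le> 1"
    and contr: "\<And>x1 x2 x3. (cmod c1)\<^sup>2 + (cmod (c2 + x1 * c1))\<^sup>2 + (cmod (c3 + x1 * c2 + x2 * c1))\<^sup>2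
        + (cmod (c4 + x1 * c3 + x2 * c2 + x3 * c1))\<^sup>2 \<le> 1 + (cmod x1)\<^sup>2 + (cmod x2)\<^sup>2 + (cmod x3)\<^sup>2"
  shows "cmod (c4 - 13/16 * c1 * c3 - 7/18 * c2\<^sup>2 - 85/288 * c1\<^sup>2 * c2 + 503/4608 * c1 ^ 4) \<le> 1"
proof -
  define u where "u = c1\<^sup>2"
  \<comment> \<open>The coefficient -13/16 of \<open>c1 * c3\<close> is split as -5/16 - 1/2, and
    -85/288 of \<open>c1\<^sup>2 * c2\<close> evenly between \<open>x2 * c2\<close> and
    \<open>x3 * c1\<close>.\<close>
  define x1 where "x1 = - 5/16 * c1"
  define x2 where "x2 = - 7/18 * c2 - 85/576 * u"
  define x3 where "x3 = - 1/2 * c3 - 85/576 * (c1 * c2) + 503/4608 * (c1 * u)"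
  define y where "y = c3 + x1 * c2 + x2 * c1"
  \<comment> \<open>Obtained by solving \<open>x3 = c1 * m - y / 2\<close>: then \<open>c3\<close>
    enters only through \<open>y\<close>, whose squared norm cancels, and a form in \<open>u\<close>
    and \<open>c2\<close> remains.\<close>
  define m where "m = 163/4608 * u - 287/576 * c2"
  define T where "T = c4 - 13/16 * c1 * c3 - 7/18 * c2\<^sup>2 - 85/288 * c1\<^sup>2 * c2 + 503/4608 * c1 ^ 4"
  have e2: "c2 + x1 * c1 = c2 - 5/16 * u"
    by (simp add: x1_def u_def power2_eq_square)
  have e4: "c4 + x1 * c3 + x2 * c2 + x3 * c1 = T"
    by (simp add: T_def x1_def x2_def x3_def u_def power2_eq_square power4_eq_xxxx algebra_simps)
  have u: "(cmod u)\<^sup>2 \<le> (cmod c1)\<^sup>2"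
    using c1 by (intro power_mono) (auto simp: u_def norm_mult power2_eq_square mult_left_le)
  have "x3 = c1 * m - y / 2"
    by (simp add: x1_def x2_def x3_def y_def m_def field_simps)
  hence "(cmod x3)\<^sup>2 \<le> (cmod y)\<^sup>2 + 4/3 * (cmod (c1 * m))\<^sup>2"
    using cmod_diff_half_sq_le by simp
  moreover have "(cmod (c1 * m))\<^sup>2 \<le> (cmod m)\<^sup>2"
    using c1 by (intro power_mono) (auto simp: norm_mult mult_left_le_one_le)
  moreover have "(cmod x1)\<^sup>2 = 25/256 * (cmod c1)\<^sup>2"
    by (simp add: x1_def norm_mult power_mult_distrib power2_eq_square)
  moreover have "25/256 * (cmod u)\<^sup>2 + (cmod x2)\<^sup>2 + 4/3 * (cmod m)\<^sup>2 \<le> (cmod u)\<^sup>2 + (cmod (c2 - 5/16 * u))\<^sup>2"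
  proof -
    have quad: "25/256 * s\<^sup>2 + (7/18 * p + 85/576 * s)\<^sup>2 + 4/3 * (163/4608 * s - 287/576 * p)\<^sup>2
        \<le> s\<^sup>2 + (p - 5/16 * s)\<^sup>2" for p s :: real
    proof -
      \<comment> \<open>Again the first weight matches the mixed term and leaves positive diagonal
        coefficients.\<close>
      have "0 \<le> 689539/1990656 * (p - s)\<^sup>2 + 37901/221184 * p\<^sup>2 + 1115063/1769472 * s\<^sup>2"
        by simp
      also have "\<dots> = s\<^sup>2 + (p - 5/16 * s)\<^sup>2
          - (25/256 * s\<^sup>2 + (7/18 * p + 85/576 * s)\<^sup>2 + 4/3 * (163/4608 * s - 287/576 * p)\<^sup>2)"
        by (simp add: power2_eq_square field_simps)
      finally show ?thesis
        by simp
    qed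
    show ?thesis
      using quad[of "Re u" "Re c2"] quad[of "Im u" "Im c2"]
      unfolding cmod_power2 x2_def m_def by (simp add: power2_eq_square algebra_simps add_divide_distrib)
  qed
  moreover have "(cmod c1)\<^sup>2 + (cmod (c2 - 5/16 * u))\<^sup>2 + (cmod y)\<^sup>2 + (cmod T)\<^sup>2
      \<le> 1 + (cmod x1)\<^sup>2 + (cmod x2)\<^sup>2 + (cmod x3)\<^sup>2"
    using contr[of x1 x2 x3] by (simp only: e2 e4 y_def)
  ultimately have "(cmod T)\<^sup>2 \<le> 1"
    using u by linarith
  hence "cmod T \<le> 1"
    by (simp add: abs_square_le_1)
  thus ?thesis
    unfolding T_def .
qed

section \<open>Logarithmic coefficients of functions in the class\<close>

text \<open>Taylor expansion at 0 turns the analytic relations between \<open>w\<close>,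
  \<open>f\<close> and the logarithm into the formal equations solved above; the factor 1/2 in
  \<open>logcoeff\<close> doubles the denominators.\<close>

lemma logcoeff_eq_Schwarz_coeffs:
  assumes w: "w holomorphic_on ball 0 1" "w ` ball 0 1 \<subseteq> ball 0 1" "w 0 = 0"
    and f: "f holomorphic_on ball 0 1" "f 0 = 0"
    and f': "\<forall>z\<in>ball 0 1. deriv f z = Bfun (w z)"
  defines "c \<equiv> fps_nth (fps_expansion w 0)"
  shows "logcoeff f 1 = c 1 / 8"
    and "logcoeff f 2 = (c 2 - 7/16 * (c 1)\<^sup>2) / 12"
    and "logcoeff f 3 = (c 3 - 5/6 * c 1 * c 2 - 1/12 * (c 1) ^ 3) / 16"
    and "logcoeff f 4 = (c 4 - 13/16 * c 1 * c 3 - 7/18 * (c 2)\<^sup>2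
            - 85/288 * (c 1)\<^sup>2 * c 2 + 503/4608 * (c 1) ^ 4) / 20"
proof -
  define F where "F = fps_expansion f 0"
  define W where "W = fps_expansion w 0"
  define g where "g = (\<lambda>z. if z = 0 then 1 else f z / z)"
  define l where "l = (\<lambda>z. Ln (g z))"
  define L where "L = fps_expansion l 0"
  have in_ball: "eventually (\<lambda>z::complex. z \<in> ball 0 1) (nhds 0)"
    by (intro eventually_nhds_in_open) auto
  have wz: "cmod (w z) < 1" if "z \<in> ball 0 1" for z
    using w(2) that by (auto simp: image_subset_iff)
  have W: "w has_fps_expansion W" and F: "f has_fps_expansion F"
    unfolding W_def F_def using has_fps_expansion_fps_expansion[of "ball 0 1"] w(1) f(1) by simp_all
  have nth0: "h 0 = X $ 0" if "h has_fps_expansion X" for h :: "complex \<Rightarrow> complex" and X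
    using fps_nth_fps_expansion[OF that, of 0] by simp
  have F': "deriv f has_fps_expansion fps_deriv F"
    by (rule has_fps_expansion_deriv[OF F])
  \<comment> \<open>The normalization of the derivative follows from \<open>w 0 = 0\<close> and
    \<open>Bfun 0 = 1\<close>.\<close>
  have F0: "F $ 0 = 0" and F1: "F $ 1 = 1"
    using nth0[OF F] nth0[OF F'] f(2) bspec[OF f', of 0] w(3) by simp_all

  have deriv2: "deriv (deriv f) z = Bfun (w z) * (2 - Bfun (w z) ^ 2) / 2 * deriv w z" if z: "z \<in> ball 0 1" for z
  proof -
    have "(w has_field_derivative deriv w z) (at z)"
      using w(1) z by (intro holomorphic_derivI) auto
    from DERIV_chain2[OF has_field_derivative_Bfun[OF wz[OF z]] this]
    have "((\<lambda>z. Bfun (w z)) has_field_derivative Bfun (w z) * (2 - Bfun (w z) ^ 2) / 2 * deriv w z) (at z)" .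
    hence "(deriv f has_field_derivative Bfun (w z) * (2 - Bfun (w z) ^ 2) / 2 * deriv w z) (at z)"
      by (rule has_field_derivative_transform_within_open[where S = "ball 0 1"]) (use z f' in auto)
    thus ?thesis
      by (rule DERIV_imp_deriv)
  qed
  have H: "2 * fps_deriv (fps_deriv F) = fps_deriv F * (2 - (fps_deriv F)\<^sup>2) * fps_deriv W"
  proof (rule fps_expansion_unique_complex)
    show "(\<lambda>z. 2 * deriv (deriv f) z) has_fps_expansion 2 * fps_deriv (fps_deriv F)"
      by (intro fps_expansion_intros F)
    have "eventually (\<lambda>z. 2 * deriv (deriv f) z = deriv f z * (2 - deriv f z ^ 2) * deriv w z) (nhds 0)"
      using in_ball by eventually_elim (simp add: deriv2 f')
    moreover have "(\<lambda>z. deriv f z * (2 - deriv f z ^ 2) * deriv w z) has_fps_expansion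
        fps_deriv F * (2 - (fps_deriv F)\<^sup>2) * fps_deriv W"
      by (intro fps_expansion_intros F W)
    ultimately show "(\<lambda>z. 2 * deriv (deriv f) z) has_fps_expansion
        fps_deriv F * (2 - (fps_deriv F)\<^sup>2) * fps_deriv W"
      by (subst has_fps_expansion_cong[OF _ refl])
  qed

  \<comment> \<open>As \<open>F\<close> has no constant term, shifting it divides \<open>f\<close>
    by z, and \<open>F $ 1 = 1\<close> is the value filled in at 0.\<close>
  have G: "g has_fps_expansion fps_shift 1 F"
  proof -
    have "1 \<le> subdegree F"
      using F0 F1 by (intro subdegree_geI) auto
    from has_fps_expansion_shift[OF F this, of 1] show ?thesis
      using F1 by (simp add: g_def power_one_right cong: if_cong)
  qed
  have g_an: "g analytic_on {0}" and g0: "g 0 = 1"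
    by (rule has_fps_expansion_imp_analytic_0[OF G]) (simp add: g_def)
  have "l analytic_on {0}"
    unfolding l_def using g_an g0 by (intro analytic_intros) auto
  hence Lexp: "l has_fps_expansion L"
    unfolding L_def by (rule analytic_at_imp_has_fps_expansion_0)
  have L: "fps_deriv L * fps_shift 1 F = fps_deriv (fps_shift 1 F)"
  proof (rule fps_expansion_unique_complex)
    show "deriv g has_fps_expansion fps_deriv (fps_shift 1 F)"
      by (intro fps_expansion_intros G)
    obtain S where S: "open S" "0 \<in> S" "g holomorphic_on S"
      using g_an by (auto simp: analytic_at)
    have "eventually (\<lambda>z. z \<in> S) (nhds 0)"
      using S by (intro eventually_nhds_in_open) auto
    \<comment> \<open>Near 0 the values of \<open>g\<close> stay within distance 1 of 1, hence off
      the branch cut of \<open>Ln\<close>, so the logarithmic derivative of \<open>g\<close> is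
      available there.\<close>
    moreover have "isCont g 0"
      using analytic_at_imp_isCont[OF g_an] .
    hence "(g \<longlongrightarrow> 1) (nhds 0)"
      using g0 by (simp add: isCont_def tendsto_nhds_iff)
    hence "eventually (\<lambda>z. g z \<in> ball 1 1) (nhds 0)"
      by (rule topological_tendstoD) auto
    ultimately have "eventually (\<lambda>z. deriv g z = deriv l z * g z) (nhds 0)"
    proof eventually_elim
      case (elim z)
      have "g z \<notin> \<real>\<^sub>\<le>\<^sub>0"
        using elim(2) abs_Re_le_cmod[of "1 - g z"] by (auto simp: complex_nonpos_Reals_iff dist_norm)
      moreover have "(g has_field_derivative deriv g z) (at z)"
        using S elim(1) by (intro holomorphic_derivI)
      ultimately have "(l has_field_derivative deriv g z / g z) (at z)"
        unfolding l_def by (auto intro!: derivative_eq_intros simp: field_simps)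
      thus ?case
        using \<open>g z \<notin> \<real>\<^sub>\<le>\<^sub>0\<close> by (auto simp: DERIV_imp_deriv)
    qed
    moreover have "(\<lambda>z. deriv l z * g z) has_fps_expansion fps_deriv L * fps_shift 1 F"
      by (intro fps_expansion_intros G Lexp)
    ultimately show "deriv g has_fps_expansion fps_deriv L * fps_shift 1 F"
      by (subst has_fps_expansion_cong[OF _ refl])
  qed
  have logc: "logcoeff f n = L $ n / 2" for n
    by (simp add: logcoeff_def L_def l_def g_def fps_expansion_def)
  have W0: "W $ 0 = 0" and H0: "fps_deriv F $ 0 = 1" and L0: "L $ 0 = 0"
    using nth0[OF W] nth0[OF Lexp] F1 w(3) g0 by (simp_all add: l_def)
  note coeffs = fps_log_coeffs_of_ODE[OF W0 H0 F0 L0 H refl L]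
  show "logcoeff f 1 = c 1 / 8"
    unfolding logc coeffs c_def W_def by simp
  show "logcoeff f 2 = (c 2 - 7/16 * (c 1)\<^sup>2) / 12"
    unfolding logc coeffs c_def W_def by simp
  show "logcoeff f 3 = (c 3 - 5/6 * c 1 * c 2 - 1/12 * (c 1) ^ 3) / 16"
    unfolding logc coeffs c_def W_def by simp
  show "logcoeff f 4 = (c 4 - 13/16 * c 1 * c 3 - 7/18 * (c 2)\<^sup>2
            - 85/288 * (c 1)\<^sup>2 * c 2 + 503/4608 * (c 1) ^ 4) / 20"
    unfolding logc coeffs c_def W_def by simp
qed

lemma norm_logcoeff_le:
  assumes "f \<in> classBT" and "n \<in> {1..4::nat}"
  shows "cmod (logcoeff f n) \<le> 1 / (4 * (real n + 1))"
proof -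
  obtain w where w: "w holomorphic_on ball 0 1" "w ` ball 0 1 \<subseteq> ball 0 1" "w 0 = 0"
    and f: "f holomorphic_on ball 0 1" "f 0 = 0"
    and f': "\<forall>z\<in>ball 0 1. deriv f z = Bfun (w z)"
    using assms(1) by (auto simp: classBT_def classS_def subordinate_def)
  define W where "W = fps_expansion w 0"
  define c where "c = fps_nth W"
  have c0: "c 0 = 0"
    using w(3) by (simp add: c_def W_def fps_expansion_def)
  \<comment> \<open>The multipliers used below have constant term 1. Since \<open>c 0 = 0\<close>,
    the product with \<open>W\<close> has no constant term, which leaves the 1 on the right-hand
    side as the bound.\<close>
  have contr: "(\<Sum>k\<le>m. (cmod ((W * fps_of_poly p) $ k))\<^sup>2) \<le> (\<Sum>k\<le>m. (cmod (fps_of_poly p $ k))\<^sup>2)"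
    for m p
    unfolding W_def
    by (rule bounded_multiplier_coeffs_le) (use w in \<open>auto simp: image_subset_iff less_imp_le\<close>)
  note nth = fps_mult_nth numeral_eq_Suc atLeast0AtMost atMost_Suc c0 c0[unfolded c_def] c_def
  have "(cmod (c 1))\<^sup>2 \<le> 1"
    using contr[where m = 1 and p = "[:1:]"] by (simp add: nth)
  hence c1: "cmod (c 1) \<le> 1"
    by (simp add: abs_square_le_1)
  have contr2: "(cmod (c 1))\<^sup>2 + (cmod (c 2 + x1 * c 1))\<^sup>2 \<le> 1 + (cmod x1)\<^sup>2" for x1
    using contr[where m = 2 and p = "[:1, x1:]"] by (simp add: nth algebra_simps)
  have contr3: "(cmod (c 1))\<^sup>2 + (cmod (c 2 + x1 * c 1))\<^sup>2 + (cmod (c 3 + x1 * c 2 + x2 * c 1))\<^sup>2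
      \<le> 1 + (cmod x1)\<^sup>2 + (cmod x2)\<^sup>2" for x1 x2
    using contr[where m = 3 and p = "[:1, x1, x2:]"] by (simp add: nth algebra_simps)
  have contr4: "(cmod (c 1))\<^sup>2 + (cmod (c 2 + x1 * c 1))\<^sup>2 + (cmod (c 3 + x1 * c 2 + x2 * c 1))\<^sup>2
      + (cmod (c 4 + x1 * c 3 + x2 * c 2 + x3 * c 1))\<^sup>2 \<le> 1 + (cmod x1)\<^sup>2 + (cmod x2)\<^sup>2 + (cmod x3)\<^sup>2"
    for x1 x2 x3
    using contr[where m = 4 and p = "[:1, x1, x2, x3:]"] by (simp add: nth algebra_simps)
  have c2: "cmod (c 2 - 7/16 * (c 1)\<^sup>2) \<le> 1"
  proof -
    \<comment> \<open>The multiplier is 1 - 7/16 \<open>c 1\<close> z, and 207/256 = 1 -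
      (7/16)^2.\<close>
    have "(cmod (c 2 - 7/16 * (c 1)\<^sup>2))\<^sup>2 \<le> 1 - 207/256 * (cmod (c 1))\<^sup>2"
      using contr2[of "- 7/16 * c 1"]
      by (simp add: norm_mult power_mult_distrib power2_eq_square field_simps)
    also have "\<dots> \<le> 1"
      by simp
    finally show ?thesis
      by (simp add: abs_square_le_1)
  qed
  note coeffs = logcoeff_eq_Schwarz_coeffs[OF w f f', folded W_def, folded c_def]
  consider "n = 1" | "n = 2" | "n = 3" | "n = 4"
    using assms(2) by force
  thus ?thesis
  proof cases
    case 1
    have "cmod (logcoeff f n) = cmod (c 1) / 8"
      unfolding 1 coeffs(1) by (simp only: norm_divide norm_numeral)
    also have "\<dots> \<le> 1 / 8"
      by (intro divide_right_mono c1) simp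
    finally show ?thesis
      by (simp add: 1)
  next
    case 2
    have "cmod (logcoeff f n) = cmod (c 2 - 7/16 * (c 1)\<^sup>2) / 12"
      unfolding 2 coeffs(2) by (simp only: norm_divide norm_numeral)
    also have "\<dots> \<le> 1 / 12"
      by (intro divide_right_mono c2) simp
    finally show ?thesis
      by (simp add: 2)
  next
    case 3
    have "cmod (logcoeff f n) = cmod (c 3 - 5/6 * c 1 * c 2 - 1/12 * c 1 ^ 3) / 16"
      unfolding 3 coeffs(3) by (simp only: norm_divide norm_numeral)
    also have "\<dots> \<le> 1 / 16"
      by (intro divide_right_mono Schwarz_functional_3[OF c1 contr3]) simp
    finally show ?thesis
      by (simp add: 3)
  next
    case 4
    have "cmod (logcoeff f n) = cmod (c 4 - 13/16 * c 1 * c 3 - 7/18 * (c 2)\<^sup>2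
        - 85/288 * (c 1)\<^sup>2 * c 2 + 503/4608 * c 1 ^ 4) / 20"
      unfolding 4 coeffs(4) by (simp only: norm_divide norm_numeral)
    also have "\<dots> \<le> 1 / 20"
      by (intro divide_right_mono Schwarz_functional_4[OF c1 contr4]) simp
    finally show ?thesis
      by (simp add: 4)
  qed
qed

section \<open>The extremal functions\<close>

text \<open>The integrand is holomorphic on the convex disc and so has a primitive there; the
  integral along the segment from 0 is a difference of its values.\<close>

lemma has_field_derivative_fext:
  assumes n: "n > 0" and z: "z \<in> ball 0 1"
  shows "(fext n has_field_derivative Bfun (z ^ n)) (at z)"
proof -
  define h where "h = (\<lambda>t. Bfun (t ^ n))"
  have pow: "cmod (t ^ n) < 1" if "t \<in> ball 0 1" for t
    using that n by (simp add: norm_power power_less_one_iff)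
  have "h field_differentiable (at t)" if "t \<in> ball 0 1" for t
  proof -
    have "((\<lambda>t. t ^ n) has_field_derivative of_nat n * t ^ (n - 1)) (at t)"
      by (auto intro!: derivative_eq_intros)
    from DERIV_chain2[OF has_field_derivative_Bfun[OF pow[OF that]] this] show ?thesis
      unfolding h_def field_differentiable_def by blast
  qed
  hence "h holomorphic_on ball 0 1"
    by (auto simp: holomorphic_on_def intro: field_differentiable_at_within)
  then obtain p where p: "\<And>t. t \<in> ball 0 1 \<Longrightarrow> (p has_field_derivative h t) (at t within ball 0 1)"
    using holomorphic_convex_primitive'[of "ball 0 1" h] by auto
  have "fext n t = p t - p 0" if t: "t \<in> ball 0 1" for t
  proof -
    have "closed_segment 0 t \<subseteq> ball 0 1"
      using t by (intro closed_segment_subset) auto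
    hence "(h has_contour_integral (p (pathfinish (linepath 0 t)) - p (pathstart (linepath 0 t)))) (linepath 0 t)"
      using contour_integral_primitive[OF p valid_path_linepath] by (simp only: path_image_linepath)
    thus ?thesis
      by (simp add: fext_def h_def contour_integral_unique)
  qed
  moreover have "(p has_field_derivative h z) (at z)"
    using p[OF z] z by (simp add: at_within_open[of z "ball 0 1"])
  hence "((\<lambda>t. p t - p 0) has_field_derivative h z) (at z)"
    using DERIV_diff[OF _ DERIV_const] by fastforce
  ultimately show ?thesis
    using z unfolding h_def
    by (metis (no_types, lifting) open_ball has_field_derivative_transform_within_open)
qed

lemma fext_0 [simp]: "fext n 0 = 0"
  by (simp add: fext_def)

text \<open>The Schwarz function is z^n, and univalence follows from the positive real part of the
  derivative.\<close>

lemma fext_in_classBT: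
  assumes n: "n > 0"
  shows "fext n \<in> classBT"
proof -
  have deriv: "deriv (fext n) z = Bfun (z ^ n)" if "z \<in> ball 0 1" for z
    using has_field_derivative_fext[OF n that] by (rule DERIV_imp_deriv)
  have pow: "cmod (z ^ n) < 1" if "z \<in> ball 0 1" for z
    using that n by (simp add: norm_power power_less_one_iff)
  have "fext n holomorphic_on ball 0 1"
    unfolding holomorphic_on_def field_differentiable_def
    using has_field_derivative_fext[OF n] has_field_derivative_at_within by blast
  moreover have "inj_on (fext n) (ball 0 1)"
    using pow by (intro Noshiro_Warschawski[where f' = "\<lambda>z. Bfun (z ^ n)"]
        has_field_derivative_fext n Re_Bfun_pos) auto
  moreover have "deriv (fext n) 0 = 1"
    using deriv[of 0] n by (simp add: power_0_left)
  moreover have "subordinate (deriv (fext n)) Bfun"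
    unfolding subordinate_def
    using pow deriv n by (intro exI[of _ "\<lambda>z. z ^ n"]) (auto intro!: holomorphic_intros)
  ultimately show ?thesis
    by (simp add: classBT_def classS_def)
qed

text \<open>For the Schwarz function z^n only the n-th coefficient is nonzero. Every nonlinear
  monomial in the formula for index n contains a coefficient of smaller index, so only the linear
  term survives.\<close>

lemma logcoeff_fext:
  assumes n: "n \<in> {1..4::nat}"
  shows "logcoeff (fext n) n = 1 / (4 * (of_nat n + 1))"
proof -
  have "n > 0"
    using n by simp
  have c: "fps_expansion (\<lambda>z::complex. z ^ n) 0 $ k = (if k = n then 1 else 0)" for k
    using fps_nth_fps_expansion[OF has_fps_expansion_fps_X_power[of n], of k]
    by (simp add: fps_expansion_def fps_X_power_nth)
  have w: "(\<lambda>z. z ^ n) holomorphic_on (ball 0 1 :: complex set)"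
    "(\<lambda>z. z ^ n) ` ball 0 1 \<subseteq> (ball 0 1 :: complex set)" "(0 :: complex) ^ n = 0"
    using \<open>n > 0\<close> by (auto simp: norm_power power_less_one_iff intro!: holomorphic_intros)
  have f: "fext n holomorphic_on ball 0 1"
    using fext_in_classBT[OF \<open>n > 0\<close>] by (simp add: classBT_def classS_def)
  have f': "\<forall>z\<in>ball 0 1. deriv (fext n) z = Bfun (z ^ n)"
    using has_field_derivative_fext[OF \<open>n > 0\<close>] by (blast intro: DERIV_imp_deriv)
  note coeffs = logcoeff_eq_Schwarz_coeffs[OF w f fext_0 f', unfolded c]
  consider "n = 1" | "n = 2" | "n = 3" | "n = 4"
    using n by force
  thus ?thesis
  proof cases
    case 1
    show ?thesis
      using coeffs(1) unfolding 1 by simp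
  next
    case 2
    show ?thesis
      using coeffs(2) unfolding 2 by simp
  next
    case 3
    show ?thesis
      using coeffs(3) unfolding 3 by simp
  next
    case 4
    show ?thesis
      using coeffs(4) unfolding 4 by simp
  qed
qed

theorem theorem3p1:
  shows "(\<forall>f\<in>classBT. \<forall>n\<in>{1..4::nat}. cmod (logcoeff f n) \<le> 1 / (4 * (real n + 1)))
       \<and> (\<forall>n\<in>{1..4::nat}. fext n \<in> classBT \<and> cmod (logcoeff (fext n) n) = 1 / (4 * (real n + 1)))"
proof (intro conjI ballI)
  fix f and n :: nat
  assume "f \<in> classBT" "n \<in> {1..4}"
  thus "cmod (logcoeff f n) \<le> 1 / (4 * (real n + 1))"
    by (rule norm_logcoeff_le)
next
  fix n :: nat
  assume n: "n \<in> {1..4}"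
  thus "fext n \<in> classBT"
    by (intro fext_in_classBT) simp
  have "logcoeff (fext n) n = of_real (1 / (4 * (real n + 1)))"
    by (simp add: logcoeff_fext[OF n])
  thus "cmod (logcoeff (fext n) n) = 1 / (4 * (real n + 1))"
    by (simp only: norm_of_real) simp
qed

end
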